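(* Let $V$ be a finite set with $|V|>1$, let $(\mathsf Z_i : i\in V)$ be discrete random variables with entropy function $H$, let $R=R_{\mathrm{ACO}}(V)$ and let $\mathcal P^*$ be the fundamental partition. Then $\hat f^{\#}_{R}$ is a separable submodular function and $\mathcal P^*$ is the set of minimal separators of $\hat f^{\#}_{R}$.
   Context: For $X\subseteq V$, $H(X)$ is the (finite) Shannon entropy of $(\mathsf Z_i: i\in X)$, $H(\emptyset)=0$, $H(X|Y)=H(X\cup Y)-H(Y)$. For $\mathbf r_V\in\mathbb R^{|V|}$, $r(X)=\sum_{i\in X}r_i$. $R_{\mathrm{ACO}}(V)=\min\{r(V): \mathbf r_V\in\mathbb R^{|V|},\ r(X)\ge H(X|V\setminus X)\ \forall X\subsetneq V\}$. $\Pi(X)$: partitions of $X$ into nonempty disjoint subsets; $\Pi'(V)=\{\mathcal P\in\Pi(V):|\mathcal P|>1\}$; for $\mathcal P\in\Pi'(V)$, $\varphi(\mathcal P)=\sum_{C\in\mathcal P}\frac{H(V)-H(C)}{|\mathcal P|-1}$. One has $R_{\mathrm{ACO}}(V)=\max_{\mathcal P\in\Pi'(V)}\varphi(\mathcal P)$, and the unique finest maximizer is the fundamental partition $\mathcal P^*$. For $\alpha\ge0$: $f^{\#}_\alpha(\emptyset)=0$, $f^{\#}_\alpha(X)=\alpha-H(V)+H(X)$ for $\emptyset\ne X\subseteq V$; Dilworth truncation $\hat f^{\#}_\alpha(X)=\min_{\mathcal P\in\Pi(X)}\sum_{C\in\mathcal P}f^{\#}_\alpha(C)$, $\hat f^{\#}_\alpha(\emptyset)=0$.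 For a submodular $f:2^V\to\mathbb R$ with $f(\emptyset)=0$, a nonempty proper subset $X\subsetneq V$ is a separator of $f$ if $f(X)+f(V\setminus X)=f(V)$; $f$ is separable if it has a separator. A partition $\mathcal P\in\Pi(V)$ is the set of minimal separators of a separable $f$ if every $X\in\mathcal P$ is a separator of $f$ and no nonempty $X'\subsetneq X$ is a separator of $f$. *)

theory Defs
  imports "HOL-Probability.Probability"
begin

text \<open>The tuple of the variables indexed by \<open>X\<close>, as an extensional function on \<open>X\<close>; for \<open>X = {}\<close> it is
  constant and has entropy 0.\<close>

definition joint_rv :: "('i \<Rightarrow> 'w \<Rightarrow> 'b) \<Rightarrow> 'i set \<Rightarrow> 'w \<Rightarrow> 'i \<Rightarrow> 'b" where
  "joint_rv Z X = (\<lambda>w. restrict (\<lambda>i. Z i w) X)"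

definition discrete_rv :: "'w measure \<Rightarrow> ('w \<Rightarrow> 'b) \<Rightarrow> bool" where
  "discrete_rv M Y \<longleftrightarrow> Y \<in> measurable M (count_space UNIV) \<and> countable (Y ` space M)"

definition joint_entropy :: "'w measure \<Rightarrow> real \<Rightarrow> ('i \<Rightarrow> 'w \<Rightarrow> 'b) \<Rightarrow> 'i set \<Rightarrow> real" where
  "joint_entropy M b Z X =
     prob_space.entropy M b (count_space (joint_rv Z X ` space M)) (joint_rv Z X)"

text \<open>
  A countably infinite alphabet may have infinite Shannon entropy, for which the real-valued
  library constant returns a junk value.  Hence finiteness is a separate condition: the series
  \<open>\<Sum>x. p x * log b (p x)\<close> over the range converges absolutely, \<open>p\<close> being the probability mass
  function of the tuple.
\<close>

definition finite_joint_entropy ::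
    "'w measure \<Rightarrow> real \<Rightarrow> ('i \<Rightarrow> 'w \<Rightarrow> 'b) \<Rightarrow> 'i set \<Rightarrow> bool" where
  "finite_joint_entropy M b Z X \<longleftrightarrow>
     information_space.finite_entropy M b
       (count_space (joint_rv Z X ` space M)) (joint_rv Z X)
       (\<lambda>x. measure M {w \<in> space M. joint_rv Z X w = x})"

text \<open>In the following, \<open>H\<close> is an arbitrary real set function (in the application, the entropy).\<close>

definition cond_entropy :: "('i set \<Rightarrow> real) \<Rightarrow> 'i set \<Rightarrow> 'i set \<Rightarrow> real" where
  "cond_entropy H X Y = H (X \<union> Y) - H Y"

text \<open>\<open>LEAST\<close> on the reals is an attained minimum, not an infimum.\<close>

definition R_ACO :: "('i set \<Rightarrow> real) \<Rightarrow> 'i set \<Rightarrow> real" where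
  "R_ACO H V = (LEAST s. \<exists>r :: 'i \<Rightarrow> real.
     (\<forall>X. X \<subset> V \<longrightarrow> sum r X \<ge> cond_entropy H X (V - X)) \<and> s = sum r V)"

definition partitions :: "'i set \<Rightarrow> 'i set set set" where
  "partitions X = {P. partition_on X P}"

definition multiway_partitions :: "'i set \<Rightarrow> 'i set set set" where
  "multiway_partitions V = {P \<in> partitions V. card P > 1}"

definition phi :: "('i set \<Rightarrow> real) \<Rightarrow> 'i set \<Rightarrow> 'i set set \<Rightarrow> real" where
  "phi H V P = (\<Sum>C\<in>P. (H V - H C) / (real (card P) - 1))"

definition phi_maximizers :: "('i set \<Rightarrow> real) \<Rightarrow> 'i set \<Rightarrow> 'i set set set" where
  "phi_maximizers H V =
     {P \<in> multiway_partitions V. \<forall>Q \<in> multiway_partitions V. phi H V Q \<le> phi H V P}"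

definition fundamental_partition :: "('i set \<Rightarrow> real) \<Rightarrow> 'i set \<Rightarrow> 'i set set" where
  "fundamental_partition H V =
     (THE P. P \<in> phi_maximizers H V \<and> (\<forall>Q \<in> phi_maximizers H V. refines V P Q))"

definition f_sharp :: "('i set \<Rightarrow> real) \<Rightarrow> 'i set \<Rightarrow> real \<Rightarrow> 'i set \<Rightarrow> real" where
  "f_sharp H V \<alpha> X = (if X = {} then 0 else \<alpha> - H V + H X)"

definition dilworth_truncation :: "('i set \<Rightarrow> real) \<Rightarrow> 'i set \<Rightarrow> real" where
  "dilworth_truncation f X = Min ((\<lambda>P. \<Sum>C\<in>P. f C) ` partitions X)"

text \<open>The only partition of the empty set is the empty one.\<close>

lemma dilworth_truncation_empty: "dilworth_truncation f {} = 0"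
  by (simp add: dilworth_truncation_def partitions_def partition_on_empty)

definition submodular_on :: "'i set \<Rightarrow> ('i set \<Rightarrow> real) \<Rightarrow> bool" where
  "submodular_on V f \<longleftrightarrow> (\<forall>X Y. X \<subseteq> V \<longrightarrow> Y \<subseteq> V \<longrightarrow> f (X \<inter> Y) + f (X \<union> Y) \<le> f X + f Y)"

definition is_separator :: "'i set \<Rightarrow> ('i set \<Rightarrow> real) \<Rightarrow> 'i set \<Rightarrow> bool" where
  "is_separator V f X \<longleftrightarrow> X \<noteq> {} \<and> X \<subset> V \<and> f X + f (V - X) = f V"

definition separable :: "'i set \<Rightarrow> ('i set \<Rightarrow> real) \<Rightarrow> bool" where
  "separable V f \<longleftrightarrow> (\<exists>X. is_separator V f X)"

definition is_minimal_separators :: "'i set \<Rightarrow> ('i set \<Rightarrow> real) \<Rightarrow> 'i set set \<Rightarrow> bool" where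
  "is_minimal_separators V f P \<longleftrightarrow>
     P \<in> partitions V \<and>
     (\<forall>X\<in>P. is_separator V f X \<and> (\<forall>X'. X' \<noteq> {} \<and> X' \<subset> X \<longrightarrow> \<not> is_separator V f X'))"

end

(* The sharp function is submodular on pairs of sets that meet, so its Dilworth truncation g is
   submodular, and g has a vector r below it with r(V) = g(V).  Hence R_ACO is the maximum of phi,
   and with R = R_ACO the maximizers of phi are exactly the partitions with at least two blocks
   whose f_sharp-value is g(V).  Every block of such a partition is a separator of g.  If the
   number of blocks is maximal, then no block contains a smaller separator, since splitting a
   block along it would give another optimal partition.  Separators are closed under nonempty
   intersections, so this partition refines all other maximizers and is the fundamental one. *)

theory Submission
  imports Defs
begin

section \<open>Submodularity of entropy\<close>

text \<open>The numerator over \<open>pC\<close> is the law under which \<open>A\<close> and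
  \<open>B\<close> are conditionally independent given their common part
  \<open>c (A) = d (B)\<close>; the mean of its ratio to \<open>pU\<close> is at most its total
  mass. In coordinates: \<open>pU\<close> cancels, \<open>u\<close> becomes the pair
  \<open>(a u, b u)\<close>, the sum of \<open>pB\<close> over the \<open>y\<close> with
  \<open>d y = c x\<close> is \<open>pC (c x)\<close>, and \<open>pA\<close> sums to 1.\<close>

lemma (in prob_space) nn_integral_conditional_independence_ratio:
  fixes pA pB pU :: "_ \<Rightarrow> real"
  assumes U: "distributed M (count_space (U ` space M)) U pU" "\<And>u. 0 \<le> pU u"
    and A: "distributed M (count_space (A ` space M)) A pA" "\<And>x. 0 \<le> pA x"
    and B: "distributed M (count_space (B ` space M)) B pB" "\<And>y. 0 \<le> pB y"
    and AU: "\<And>w. w \<in> space M \<Longrightarrow> A w = a (U w)" and BU: "\<And>w. w \<in> space M \<Longrightarrow> B w = b (U w)"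
    and inj: "inj_on (\<lambda>u. (a u, b u)) (U ` space M)"
    and cd: "\<And>w. w \<in> space M \<Longrightarrow> c (A w) = d (B w)"
  defines "pC \<equiv> \<lambda>z. prob {w \<in> space M. c (A w) = z}"
  shows "(\<integral>\<^sup>+w. ennreal (pA (A w) * pB (B w) / (pU (U w) * pC (c (A w)))) \<partial>M) \<le> 1"
proof -
  let ?RU = "U ` space M" and ?RA = "A ` space M" and ?RB = "B ` space M"
  define h where "h u = ennreal (pA (a u) * pB (b u) / (pU u * pC (c (a u))))" for u
  define K where "K x y = ennreal (pB y) * indicator {y. d y = c x} y" for x y
  define F where "F x y = ennreal (pA x) * (ennreal (1 / pC (c x)) * K x y)" for x y
  have Bm: "B \<in> measurable M (count_space ?RB)"
    using B(1) by (simp add: distributed_def)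
  have "(\<integral>\<^sup>+w. ennreal (pA (A w) * pB (B w) / (pU (U w) * pC (c (A w)))) \<partial>M) = (\<integral>\<^sup>+w. h (U w) \<partial>M)"
    by (intro nn_integral_cong) (simp add: h_def AU BU)
  also have "\<dots> = (\<integral>\<^sup>+u. ennreal (pU u) * h u \<partial>count_space ?RU)"
    by (intro distributed_nn_integral[OF U(1), symmetric]) simp
  also have "\<dots> \<le> (\<integral>\<^sup>+u. F (a u) (b u) \<partial>count_space ?RU)"
  proof (rule nn_integral_mono)
    fix u assume "u \<in> space (count_space ?RU)"
    then have "d (b u) = c (a u)" using AU BU cd by auto
    moreover have "pC z \<ge> 0" for z by (simp add: pC_def)
    \<comment> \<open>Only an inequality: where \<open>pU u = 0\<close> the left side vanishes,
      while the right side may be positive.\<close>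
    ultimately show "ennreal (pU u) * h u \<le> F (a u) (b u)"
      using U(2)[of u] A(2)[of "a u"] B(2)[of "b u"]
      by (cases "pU u = 0") (simp_all add: h_def F_def K_def ennreal_mult[symmetric] field_simps)
  qed
  also have "\<dots> = (\<integral>\<^sup>+z. F (fst z) (snd z) \<partial>count_space ((\<lambda>u. (a u, b u)) ` ?RU))"
    using nn_integral_bij_count_space[OF inj_on_imp_bij_betw[OF inj],
        of "\<lambda>z. F (fst z) (snd z)"] by simp
  also have "\<dots> = (\<integral>\<^sup>+z. F (fst z) (snd z) * indicator ((\<lambda>u. (a u, b u)) ` ?RU) z \<partial>count_space UNIV)"
    by (rule nn_integral_count_space_indicator) simp
  also have "\<dots> \<le> (\<integral>\<^sup>+z. F (fst z) (snd z) * indicator (?RA \<times> ?RB) z \<partial>count_space UNIV)"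
    using AU BU
    by (intro nn_integral_mono mult_left_mono) (auto simp: indicator_def split: if_splits)
  also have "\<dots> = (\<integral>\<^sup>+x. \<integral>\<^sup>+y. F x y * indicator (?RA \<times> ?RB) (x, y) \<partial>count_space UNIV \<partial>count_space UNIV)"
    by (subst nn_integral_fst_count_space[symmetric]) simp
  also have "\<dots> \<le> (\<integral>\<^sup>+x. ennreal (pA x) * indicator ?RA x \<partial>count_space UNIV)"
  proof (rule nn_integral_mono)
    fix x
    have "(\<integral>\<^sup>+y. F x y * indicator (?RA \<times> ?RB) (x, y) \<partial>count_space UNIV)
        = (\<integral>\<^sup>+y. (ennreal (pA x) * indicator ?RA x * ennreal (1 / pC (c x))) * (K x y * indicator ?RB y)
            \<partial>count_space UNIV)"
      by (intro nn_integral_cong) (auto simp: F_def indicator_def mult_ac)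
    also have "\<dots> = ennreal (pA x) * indicator ?RA x * ennreal (1 / pC (c x)) *
        (\<integral>\<^sup>+y. K x y * indicator ?RB y \<partial>count_space UNIV)"
      by (intro nn_integral_cmult) simp
    also have "(\<integral>\<^sup>+y. K x y * indicator ?RB y \<partial>count_space UNIV) = (\<integral>\<^sup>+y. K x y \<partial>count_space ?RB)"
      by (rule nn_integral_count_space_indicator[symmetric]) simp
    also have "\<dots> = (\<integral>\<^sup>+w. indicator {y. d y = c x} (B w) \<partial>M)"
      unfolding K_def by (intro distributed_nn_integral[OF B(1)]) simp
    also have "\<dots> = (\<integral>\<^sup>+w. indicator (B -` {y \<in> ?RB. d y = c x} \<inter> space M) w \<partial>M)"
      by (intro nn_integral_cong) (auto simp: indicator_def)
    also have "\<dots> = emeasure M (B -` {y \<in> ?RB. d y = c x} \<inter> space M)"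
      by (intro nn_integral_indicator measurable_sets[OF Bm]) simp
    also have "B -` {y \<in> ?RB. d y = c x} \<inter> space M = {w \<in> space M. c (A w) = c x}"
      using cd by auto
    also have "emeasure M \<dots> = ennreal (pC (c x))"
      by (simp add: pC_def emeasure_eq_measure)
    \<comment> \<open>Again not an equation: if \<open>pC (c x) = 0\<close>, then
      \<open>1 / pC (c x)\<close> is 0 by convention.\<close>
    also have "ennreal (pA x) * indicator ?RA x * ennreal (1 / pC (c x)) * ennreal (pC (c x))
        \<le> ennreal (pA x) * indicator ?RA x * 1"
      unfolding mult.assoc
      by (intro mult_left_mono)
        (auto simp: pC_def ennreal_mult[symmetric])
    finally show "(\<integral>\<^sup>+y. F x y * indicator (?RA \<times> ?RB) (x, y) \<partial>count_space UNIV)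
        \<le> ennreal (pA x) * indicator ?RA x" by simp
  qed
  also have "\<dots> = (\<integral>\<^sup>+x. ennreal (pA x) \<partial>count_space ?RA)"
    by (rule nn_integral_count_space_indicator[symmetric]) simp
  also have "\<dots> = (\<integral>\<^sup>+x. ennreal (pA x) * 1 \<partial>count_space ?RA)" by simp
  also have "\<dots> = (\<integral>\<^sup>+w. 1 \<partial>M)"
    by (intro distributed_nn_integral[OF A(1)]) simp
  also have "\<dots> = 1" by (simp add: emeasure_space_1)
  finally show ?thesis .
qed

section \<open>Entropies as expectations, and Gibbs' inequality for tuples\<close>

context information_space
begin

definition joint_pmf :: "('i \<Rightarrow> 'a \<Rightarrow> 'b) \<Rightarrow> 'i set \<Rightarrow> ('i \<Rightarrow> 'b) \<Rightarrow> real" where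
  "joint_pmf Z X x = prob {w \<in> space M. joint_rv Z X w = x}"

lemma joint_pmf_nonneg: "0 \<le> joint_pmf Z X x"
  by (simp add: joint_pmf_def)

lemma finite_joint_entropy_distributed:
  assumes "finite_joint_entropy M b Z X"
  shows "distributed M (count_space (joint_rv Z X ` space M)) (joint_rv Z X) (joint_pmf Z X)"
  using finite_entropy_distributed[OF assms[unfolded finite_joint_entropy_def]]
  by (simp add: joint_pmf_def[abs_def])

lemma finite_joint_entropy_integrable:
  assumes "finite_joint_entropy M b Z X"
  shows "integrable M (\<lambda>w. log b (joint_pmf Z X (joint_rv Z X w)))"
  using distributed_integrable[OF finite_joint_entropy_distributed[OF assms],
      of "\<lambda>x. log b (joint_pmf Z X x)"] joint_pmf_nonneg
    finite_entropy_integrable[OF assms[unfolded finite_joint_entropy_def]]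
  by (simp add: joint_pmf_def)

text \<open>Tuples for different index sets have different ranges; as means over the common space
  \<open>M\<close>, their entropies can be compared pointwise.\<close>

lemma joint_entropy_eq_expectation:
  assumes "finite_joint_entropy M b Z X"
  shows "joint_entropy M b Z X = - (\<integral>w. log b (joint_pmf Z X (joint_rv Z X w)) \<partial>M)"
proof -
  let ?S = "count_space (joint_rv Z X ` space M)"
  note D = finite_joint_entropy_distributed[OF assms]
  have "joint_entropy M b Z X = - (\<integral>x. joint_pmf Z X x * log b (joint_pmf Z X x) \<partial>?S)"
    unfolding joint_entropy_def by (rule entropy_distr[OF D joint_pmf_nonneg])
  also have "(\<integral>x. joint_pmf Z X x * log b (joint_pmf Z X x) \<partial>?S)
      = (\<integral>w. log b (joint_pmf Z X (joint_rv Z X w)) \<partial>M)"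
    by (rule distributed_integral[OF D _ joint_pmf_nonneg]) simp
  finally show ?thesis .
qed

lemma AE_joint_pmf_pos:
  assumes "finite_joint_entropy M b Z X"
  shows "AE w in M. 0 < joint_pmf Z X (joint_rv Z X w)"
  by (subst distributed_AE2[OF finite_joint_entropy_distributed[OF assms]]) auto

text \<open>Gibbs' inequality for the ratio of the joint law to the law under which the variables in
  \<open>X\<close> and in \<open>Y\<close> are conditionally independent given those in \<open>X \<inter> Y\<close>.\<close>

lemma joint_entropy_submodular:
  assumes X: "finite_joint_entropy M b Z X" and Y: "finite_joint_entropy M b Z Y"
    and I: "finite_joint_entropy M b Z (X \<inter> Y)" and U: "finite_joint_entropy M b Z (X \<union> Y)"
  shows "joint_entropy M b Z (X \<inter> Y) + joint_entropy M b Z (X \<union> Y)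
    \<le> joint_entropy M b Z X + joint_entropy M b Z Y"
proof -
  let ?p = "\<lambda>S w. joint_pmf Z S (joint_rv Z S w)"
  define q where "q w = ?p X w * ?p Y w / (?p (X \<union> Y) w * ?p (X \<inter> Y) w)" for w
  have restr: "joint_rv Z S w = restrict (joint_rv Z T w) S" if "S \<subseteq> T" for S T w
    using that by (auto simp: joint_rv_def fun_eq_iff restrict_def)
  have I_restr: "restrict (joint_rv Z X w) Y = joint_rv Z (X \<inter> Y) w"
    "restrict (joint_rv Z Y w) X = joint_rv Z (X \<inter> Y) w" for w
    by (auto simp: joint_rv_def fun_eq_iff restrict_def)
  \<comment> \<open>Tuples on \<open>X \<union> Y\<close> are extensional, so their two restrictions
    determine them everywhere.\<close>
  have inj: "inj_on (\<lambda>u. (restrict u X, restrict u Y)) (joint_rv Z (X \<union> Y) ` space M)"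
  proof (rule inj_onI)
    fix u v
    assume u: "u \<in> joint_rv Z (X \<union> Y) ` space M" and v: "v \<in> joint_rv Z (X \<union> Y) ` space M"
      and eq: "(restrict u X, restrict u Y) = (restrict v X, restrict v Y)"
    show "u = v"
    proof
      fix i
      have "restrict u X i = restrict v X i" "restrict u Y i = restrict v Y i"
        using eq by auto
      then show "u i = v i"
        using u v by (cases "i \<in> X"; cases "i \<in> Y") (auto simp: joint_rv_def)
    qed
  qed
  \<comment> \<open>Here \<open>U\<close>, \<open>A\<close>, \<open>B\<close> are the tuples on
    \<open>X \<union> Y\<close>, \<open>X\<close>, \<open>Y\<close>. Restricting the tuple on
    \<open>X\<close> to \<open>Y\<close>, or that on \<open>Y\<close> to \<open>X\<close>, yields
    the common part, the tuple on \<open>X \<inter> Y\<close>.\<close>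
  have q_le: "(\<integral>\<^sup>+w. ennreal (q w) \<partial>M) \<le> 1"
    using nn_integral_conditional_independence_ratio[
        OF finite_joint_entropy_distributed[OF U] joint_pmf_nonneg
          finite_joint_entropy_distributed[OF X] joint_pmf_nonneg
          finite_joint_entropy_distributed[OF Y] joint_pmf_nonneg
          restr[of X "X \<union> Y"] restr[of Y "X \<union> Y"] inj,
        of "\<lambda>x. restrict x Y" "\<lambda>y. restrict y X"]
    unfolding q_def I_restr joint_pmf_def by simp
  have q_nonneg: "0 \<le> q w" for w
    by (simp add: q_def joint_pmf_nonneg)
  have meas: "?p S \<in> borel_measurable M" if "finite_joint_entropy M b Z S" for S
  proof -
    have "joint_rv Z S \<in> measurable M (count_space (joint_rv Z S ` space M))"
      using finite_joint_entropy_distributed[OF that] by (simp add: distributed_def)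
    from measurable_compose[OF this, of "joint_pmf Z S" borel] show ?thesis by simp
  qed
  have [measurable]: "q \<in> borel_measurable M"
    unfolding q_def[abs_def] using X Y I U by (intro borel_measurable_times borel_measurable_divide meas)
  have "(\<integral>\<^sup>+w. ennreal (q w) \<partial>M) < \<infinity>"
    using q_le by (rule le_less_trans) simp
  then have q_int: "integrable M q"
    using q_nonneg by (intro integrableI_nonneg) auto
  have q_exp: "(\<integral>w. q w \<partial>M) \<le> 1"
    using q_le q_nonneg by (simp add: nn_integral_eq_integral[OF q_int])
  note int = finite_joint_entropy_integrable
  note pos = AE_joint_pmf_pos
  have "(\<integral>w. log b (?p X w) + log b (?p Y w) - log b (?p (X \<union> Y) w) - log b (?p (X \<inter> Y) w) \<partial>M)
      \<le> (\<integral>w. (q w - 1) / ln b \<partial>M)"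
  \<comment> \<open>Since \<open>log b t\<close> is at most \<open>(t - 1) / ln b\<close> for
    positive \<open>t\<close>, the mean of \<open>log b (q w)\<close> is controlled by that of
    \<open>q\<close>. Finite entropies make the four logarithms integrable, and almost surely
    positive arguments let them combine into one.\<close>
  proof (rule integral_mono_AE)
    show "integrable M (\<lambda>w. log b (?p X w) + log b (?p Y w) - log b (?p (X \<union> Y) w) - log b (?p (X \<inter> Y) w))"
      using X Y I U by (intro Bochner_Integration.integrable_add Bochner_Integration.integrable_diff int)
    show "integrable M (\<lambda>w. (q w - 1) / ln b)" using q_int by auto
    show "AE w in M. log b (?p X w) + log b (?p Y w) - log b (?p (X \<union> Y) w) - log b (?p (X \<inter> Y) w)
        \<le> (q w - 1) / ln b"
      using pos[OF X] pos[OF Y] pos[OF U] pos[OF I]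
    proof eventually_elim
      case (elim w)
      have "log b (?p X w) + log b (?p Y w) - log b (?p (X \<union> Y) w) - log b (?p (X \<inter> Y) w) = log b (q w)"
        using elim b_gt_1 by (simp add: q_def log_divide log_mult)
      also have "\<dots> \<le> (q w - 1) / ln b"
        using elim b_gt_1 by (simp add: log_def q_def divide_right_mono ln_le_minus_one)
      finally show ?case .
    qed
  qed
  also have "\<dots> = ((\<integral>w. q w \<partial>M) - 1) / ln b"
    using q_int by (simp add: prob_space)
  also have "\<dots> \<le> 0"
    using q_exp b_gt_1 by (simp add: divide_nonpos_pos)
  finally show ?thesis
    using int[OF X] int[OF Y] int[OF I] int[OF U]
    by (simp add: joint_entropy_eq_expectation X Y I U)
qed

end

section \<open>Dilworth truncation\<close>

lemma finite_partitions: "finite X \<Longrightarrow> finite (partitions X)"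
  unfolding partitions_def by (rule finitely_many_partition_on)

lemma partition_on_disjoint_Un:
  assumes "partition_on X P" "partition_on Y Q" "X \<inter> Y = {}"
  shows "partition_on (X \<union> Y) (P \<union> Q)" and "P \<inter> Q = {}"
proof -
  have *: "p \<inter> q = {}" if "p \<in> P" "q \<in> Q" for p q
    using assms that by (auto simp: partition_on_def)
  show "P \<inter> Q = {}"
    using * partition_onD3[OF assms(1)] by (metis Int_absorb disjoint_iff)
  show "partition_on (X \<union> Y) (P \<union> Q)"
  proof (rule partition_onI)
    show "\<Union>(P \<union> Q) = X \<union> Y" "{} \<notin> P \<union> Q"
      using assms by (auto simp: partition_on_def)
    fix p q assume pq: "p \<in> P \<union> Q" "q \<in> P \<union> Q" "p \<noteq> q"
    consider "p \<in> P" "q \<in> P" | "p \<in> P" "q \<in> Q" | "p \<in> Q" "q \<in> P" | "p \<in> Q" "q \<in> Q"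
      using pq by blast
    then show "disjnt p q"
      using * pq(3) partition_onD2[OF assms(1)] partition_onD2[OF assms(2)]
      by cases (auto simp: disjnt_def disjoint_def Int_commute)
  qed
qed

lemma partition_on_remove_block:
  assumes "partition_on X P" "C \<in> P"
  shows "partition_on (X - C) (P - {C})"
  using assms by (auto simp: partition_on_def disjoint_def)

lemma dilworth_truncation_le:
  assumes "finite X" "partition_on X P"
  shows "dilworth_truncation f X \<le> sum f P"
  unfolding dilworth_truncation_def using assms
  by (intro Min_le finite_imageI finite_partitions) (auto simp: partitions_def)

lemma dilworth_truncation_le_self:
  assumes "finite X" "X \<noteq> {}"
  shows "dilworth_truncation f X \<le> f X"
  using dilworth_truncation_le[OF assms(1) partition_on_space[OF assms(2)]] by simp

lemma dilworth_truncation_attained: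
  assumes "finite X"
  obtains P where "partition_on X P" "dilworth_truncation f X = sum f P"
proof -
  have "partitions X \<noteq> {}"
    using partition_on_singletons[of X] by (auto simp: partitions_def)
  hence "dilworth_truncation f X \<in> (\<lambda>P. sum f P) ` partitions X"
    unfolding dilworth_truncation_def
    by (intro Min_in finite_imageI finite_partitions assms) simp
  thus thesis using that by (auto simp: partitions_def)
qed

text \<open>Optimal partitions of the two disjoint sets together form a partition of the
  union.\<close>

lemma dilworth_truncation_subadditive:
  assumes "finite X" "finite Y" "X \<inter> Y = {}"
  shows "dilworth_truncation f (X \<union> Y) \<le> dilworth_truncation f X + dilworth_truncation f Y"
proof -
  obtain P where P: "partition_on X P" "dilworth_truncation f X = sum f P"
    using dilworth_truncation_attained[OF assms(1)] .
  obtain Q where Q: "partition_on Y Q" "dilworth_truncation f Y = sum f Q"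
    using dilworth_truncation_attained[OF assms(2)] .
  note U = partition_on_disjoint_Un[OF P(1) Q(1) assms(3)]
  have "dilworth_truncation f (X \<union> Y) \<le> sum f (P \<union> Q)"
    using dilworth_truncation_le[OF _ U(1)] assms by simp
  also have "\<dots> = sum f P + sum f Q"
    using U(2) P(1) Q(1) assms by (intro sum.union_disjoint) (auto intro: finite_elements)
  finally show ?thesis using P Q by simp
qed

text \<open>Submodularity is asked of meeting pairs only: \<open>f_sharp\<close> is reset to 0 on
  the empty set, so on disjoint pairs the inequality can fail.\<close>

locale intersecting_submodular =
  fixes V :: "'i set" and f :: "'i set \<Rightarrow> real"
  assumes finite_V: "finite V"
    and intersecting: "\<And>X Y. X \<subseteq> V \<Longrightarrow> Y \<subseteq> V \<Longrightarrow> X \<inter> Y \<noteq> {} \<Longrightarrow>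
      f (X \<inter> Y) + f (X \<union> Y) \<le> f X + f Y"
begin

abbreviation "g \<equiv> dilworth_truncation f"

lemma finite_subset_V: "X \<subseteq> V \<Longrightarrow> finite X"
  using finite_V finite_subset by blast

text \<open>Adding a single set \<open>C\<close> to a partition merges it with the blocks that it meets, one block at
  a time; the intersections that are split off partition the common part.\<close>

lemma uncross_block:
  assumes "finite P" "partition_on X P" "X \<subseteq> V" "C \<subseteq> V" "C \<noteq> {}"
  shows "g (X \<union> C) + g (X \<inter> C) \<le> sum f P + f C"
  using assms
proof (induction P arbitrary: X C rule: finite_induct)
  case empty
  then have "X = {}" by (simp add: partition_on_def)
  then show ?case
    using dilworth_truncation_le_self[OF finite_subset_V] empty
    by (simp add: dilworth_truncation_empty)
next
  case (insert D P)
  define X' where "X' = X - D"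
  have X': "partition_on X' P"
    using partition_on_remove_block[OF insert.prems(1), of D] insert.hyps by (simp add: X'_def)
  have D: "D \<subseteq> X" "D \<noteq> {}"
    using insert.prems by (auto simp: partition_on_def)
  have XV: "X' \<subseteq> V" and DV: "D \<subseteq> V"
    using D insert.prems by (auto simp: X'_def)
  note fin = finite_subset_V
  show ?case
  proof (cases "D \<inter> C = {}")
    case True
    have "X \<union> C = (X' \<union> C) \<union> D" "(X' \<union> C) \<inter> D = {}"
      using True D by (auto simp: X'_def)
    then have "g (X \<union> C) \<le> g (X' \<union> C) + g D"
      using dilworth_truncation_subadditive[of "X' \<union> C" D f] fin[OF XV] fin[OF DV]
        fin[OF insert.prems(3)] by simp
    moreover have "g D \<le> f D"
      using dilworth_truncation_le_self[OF fin[OF DV] D(2)] .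
    moreover have "X \<inter> C = X' \<inter> C" using True by (auto simp: X'_def)
    ultimately show ?thesis
      using insert.IH[OF X' XV insert.prems(3,4)] insert.hyps by simp
  next
    case False
    have "X' \<union> (C \<union> D) = X \<union> C" "X' \<inter> (C \<union> D) = X' \<inter> C"
      using D by (auto simp: X'_def)
    \<comment> \<open>The induction hypothesis is applied to the enlarged set
      \<open>C \<union> D\<close>, which is why \<open>C\<close> is generalized; \<open>X'\<close>
      avoids \<open>D\<close>, so its intersection with \<open>C\<close> is unchanged.\<close>
    then have 1: "g (X \<union> C) + g (X' \<inter> C) \<le> sum f P + f (C \<union> D)"
      using insert.IH[OF X' XV, of "C \<union> D"] insert.prems DV by simp
    have "X \<inter> C = X' \<inter> C \<union> D \<inter> C" using D by (auto simp: X'_def)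
    moreover have "(X' \<inter> C) \<inter> (D \<inter> C) = {}" by (auto simp: X'_def)
    ultimately have 2: "g (X \<inter> C) \<le> g (X' \<inter> C) + g (D \<inter> C)"
      using dilworth_truncation_subadditive[of "X' \<inter> C" "D \<inter> C" f] fin[OF XV] fin[OF DV] by simp
    have 3: "g (D \<inter> C) \<le> f (D \<inter> C)"
      using dilworth_truncation_le_self[of "D \<inter> C" f] False fin[OF DV] by simp
    have 4: "f (D \<inter> C) + f (D \<union> C) \<le> f D + f C"
      using intersecting[OF DV insert.prems(3) False] .
    show ?thesis using 1 2 3 4 insert.hyps by (simp add: Un_commute)
  qed
qed

text \<open>The blocks of \<open>Q\<close> are merged into \<open>X\<close> one by one, each by
  \<open>uncross_block\<close>. The pieces \<open>X \<inter> C\<close> split off on the way are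
  disjoint with union \<open>X \<inter> Y\<close>, so subadditivity collects them.\<close>

lemma uncross_partition:
  assumes "finite Q" "partition_on Y Q" "X \<subseteq> V" "Y \<subseteq> V"
  shows "g (X \<inter> Y) + g (X \<union> Y) \<le> g X + sum f Q"
  using assms
proof (induction Q arbitrary: X Y rule: finite_induct)
  case empty
  then have "Y = {}" by (simp add: partition_on_def)
  then show ?case by (simp add: dilworth_truncation_empty)
next
  case (insert C Q)
  define Y' where "Y' = Y - C"
  have Y': "partition_on Y' Q"
    using partition_on_remove_block[OF insert.prems(1), of C] insert.hyps by (simp add: Y'_def)
  have C: "C \<subseteq> Y" "C \<noteq> {}"
    using insert.prems by (auto simp: partition_on_def)
  have CV: "C \<subseteq> V" and YV: "Y' \<subseteq> V" using C insert.prems by (auto simp: Y'_def)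
  \<comment> \<open>\<open>X\<close> grows with each merged block, so an optimal partition is chosen
    anew every time.\<close>
  obtain P where P: "partition_on X P" "g X = sum f P"
    using dilworth_truncation_attained[OF finite_subset_V[OF insert.prems(2)]] .
  have 1: "g (X \<union> C) + g (X \<inter> C) \<le> g X + f C"
    unfolding P(2) using uncross_block[OF _ P(1) insert.prems(2) CV C(2)] P(1)
      finite_elements[OF finite_subset_V[OF insert.prems(2)]] by blast
  have 2: "g ((X \<union> C) \<inter> Y') + g ((X \<union> C) \<union> Y') \<le> g (X \<union> C) + sum f Q"
    using insert.IH[OF Y', of "X \<union> C"] insert.prems CV YV by simp
  have "X \<inter> Y = (X \<union> C) \<inter> Y' \<union> X \<inter> C" "((X \<union> C) \<inter> Y') \<inter> (X \<inter> C) = {}"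
    "(X \<union> C) \<union> Y' = X \<union> Y"
    using C by (auto simp: Y'_def)
  then have "g (X \<inter> Y) \<le> g ((X \<union> C) \<inter> Y') + g (X \<inter> C)"
    and "(X \<union> C) \<union> Y' = X \<union> Y"
    using dilworth_truncation_subadditive[of "(X \<union> C) \<inter> Y'" "X \<inter> C" f]
      finite_subset_V[OF YV] finite_subset_V[OF CV] by simp_all
  then show ?case using 1 2 insert.hyps by simp
qed

lemma submodular_dilworth: "submodular_on V g"
  unfolding submodular_on_def
proof (intro allI impI)
  fix X Y assume XY: "X \<subseteq> V" "Y \<subseteq> V"
  obtain Q where Q: "partition_on Y Q" "g Y = sum f Q"
    using dilworth_truncation_attained[OF finite_subset_V[OF XY(2)]] .
  show "g (X \<inter> Y) + g (X \<union> Y) \<le> g X + g Y"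
    unfolding Q(2) using uncross_partition[OF _ Q(1) XY] Q(1)
      finite_elements[OF finite_subset_V[OF XY(2)]] by blast
qed

section \<open>Separators of the truncation and optimal partitions\<close>

lemma separator_Int:
  assumes X: "is_separator V g X" and Y: "is_separator V g Y" and ne: "X \<inter> Y \<noteq> {}"
  shows "is_separator V g (X \<inter> Y)"
proof -
  have sub: "X \<subseteq> V" "Y \<subseteq> V" "V - X \<subseteq> V" "V - Y \<subseteq> V"
    using X Y by (auto simp: is_separator_def)
  \<comment> \<open>Submodularity for the pair and for the pair of complements bounds four values by
    \<open>2 * g V\<close> in total. Grouped as complementary pairs, each two of them sum to at
    least \<open>g V\<close> by subadditivity, so equality holds throughout.\<close>
  have 1: "g (X \<inter> Y) + g (X \<union> Y) \<le> g X + g Y"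
    and 2: "g ((V - X) \<inter> (V - Y)) + g ((V - X) \<union> (V - Y)) \<le> g (V - X) + g (V - Y)"
    using submodular_dilworth sub unfolding submodular_on_def by blast+
  have eq: "(V - X) \<inter> (V - Y) = V - (X \<union> Y)" "(V - X) \<union> (V - Y) = V - X \<inter> Y" by auto
  have sa: "g V \<le> g S + g (V - S)" if "S \<subseteq> V" for S
    using dilworth_truncation_subadditive[of S "V - S" f] finite_subset_V[OF that] finite_V that
    by (simp add: Un_absorb1)
  have "g V \<le> g (X \<inter> Y) + g (V - X \<inter> Y)" "g V \<le> g (X \<union> Y) + g (V - (X \<union> Y))"
    using sub by (intro sa; blast)+
  moreover have "g X + g (V - X) = g V" "g Y + g (V - Y) = g V"
    using X Y by (simp_all add: is_separator_def)
  ultimately have "g (X \<inter> Y) + g (V - X \<inter> Y) = g V"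
    using 1 2 unfolding eq by linarith
  thus ?thesis using ne X by (auto simp: is_separator_def)
qed

text \<open>In the chain from \<open>sum f P\<close> through \<open>g C + g (V - C)\<close> to
  \<open>g V\<close> each term bounds the next one from above, and optimality makes the ends equal.
  A second block keeps \<open>C\<close> proper.\<close>

lemma block_is_separator:
  assumes P: "partition_on V P" and opt: "sum f P = g V" and "C \<in> P" "P \<noteq> {C}"
  shows "is_separator V g C"
proof -
  have CV: "C \<subseteq> V" "C \<noteq> {}" using P \<open>C \<in> P\<close> by (auto simp: partition_on_def)
  have "C \<noteq> V"
  proof
    assume "C = V"
    then have "partition_on {} (P - {C})"
      using partition_on_remove_block[OF P \<open>C \<in> P\<close>] by simp
    then show False using assms(3,4) by (auto simp: partition_on_empty)
  qed
  have finP: "finite P" using finite_elements[OF finite_V P] .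
  have "g (V - C) \<le> sum f (P - {C})"
    using partition_on_remove_block[OF P \<open>C \<in> P\<close>] finite_V by (intro dilworth_truncation_le) auto
  moreover have "g C \<le> f C"
    using dilworth_truncation_le_self[OF finite_subset_V[OF CV(1)] CV(2)] .
  moreover have "sum f P = f C + sum f (P - {C})"
    using finP \<open>C \<in> P\<close> by (simp add: sum.remove)
  moreover have "g V \<le> g C + g (V - C)"
    using dilworth_truncation_subadditive[of C "V - C" f] finite_subset_V[OF CV(1)] finite_V CV
    by (simp add: Un_absorb1)
  ultimately have "g C + g (V - C) = g V" using opt by linarith
  thus ?thesis using CV \<open>C \<noteq> V\<close> by (auto simp: is_separator_def)
qed

text \<open>Submodularity for \<open>C\<close> and \<open>V - S\<close>, whose union is
  \<open>V\<close>: a separator of the whole set also splits every set that contains it.\<close>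

lemma separator_splits:
  assumes S: "is_separator V g S" and "S \<subseteq> C" "C \<subseteq> V"
  shows "g S + g (C - S) \<le> g C"
proof -
  have "g (C \<inter> (V - S)) + g (C \<union> (V - S)) \<le> g C + g (V - S)"
    using submodular_dilworth assms(3) unfolding submodular_on_def by blast
  moreover have "C \<inter> (V - S) = C - S" "C \<union> (V - S) = V"
    using assms by auto
  ultimately show ?thesis using S by (simp add: is_separator_def)
qed

text \<open>Maximizing the number of blocks over the finite set \<open>Opt\<close> replaces the
  search for a finest element; fineness follows afterwards from the minimality of the blocks as
  separators.\<close>

lemma finest_optimal_partition:
  assumes Q: "partition_on V Q" "sum f Q = g V" "card Q > 1"
  obtains W where "partition_on V W" "sum f W = g V" "card W > 1"
    "\<And>C. C \<in> W \<Longrightarrow> is_separator V g C"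
    "\<And>C S. C \<in> W \<Longrightarrow> S \<noteq> {} \<Longrightarrow> S \<subset> C \<Longrightarrow> \<not> is_separator V g S"
    "\<And>P. partition_on V P \<Longrightarrow> sum f P = g V \<Longrightarrow> card P > 1 \<Longrightarrow> refines V W P"
proof -
  define Opt where "Opt = {P. partition_on V P \<and> sum f P = g V}"
  have "finite Opt" unfolding Opt_def
    by (rule finite_subset[OF _ finite_partitions[OF finite_V]]) (auto simp: partitions_def)
  moreover have "Q \<in> Opt" using Q by (simp add: Opt_def)
  ultimately obtain W where W: "W \<in> Opt" "\<And>P. P \<in> Opt \<Longrightarrow> card P \<le> card W"
    using obtains_MAX[of Opt card] by (metis Max_ge emptyE finite_imageI imageI)
  have PW: "partition_on V W" and fW: "sum f W = g V" using W by (auto simp: Opt_def)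
  have cW: "card W > 1" using W(2)[OF \<open>Q \<in> Opt\<close>] Q(3) by simp
  have finW: "finite W" using finite_elements[OF finite_V PW] .
  have sep: "is_separator V g C" if "C \<in> W" for C
    using cW that by (intro block_is_separator[OF PW fW]) auto
  have min: "\<not> is_separator V g S" if C: "C \<in> W" and S: "S \<noteq> {}" "S \<subset> C" for C S
  proof
    \<comment> \<open>The blocks of \<open>A\<close> and \<open>B\<close> replace \<open>C\<close>.
      The value does not rise, since \<open>g S + g (C - S)\<close> is at most \<open>g C\<close>
      and hence \<open>f C\<close>, but the number of blocks goes up by at least one.\<close>
    assume sepS: "is_separator V g S"
    have CV: "C \<subseteq> V" using PW C by (auto simp: partition_on_def)
    have finS: "finite S" "finite (C - S)"
      using finite_subset_V[OF CV] S by (auto intro: finite_subset)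
    obtain A where A: "partition_on S A" "g S = sum f A"
      using dilworth_truncation_attained[OF finS(1)] .
    obtain B where B: "partition_on (C - S) B" "g (C - S) = sum f B"
      using dilworth_truncation_attained[OF finS(2)] .
    have fin: "finite A" "finite B"
      using finite_elements[OF finS(1) A(1)] finite_elements[OF finS(2) B(1)] by auto
    have "A \<noteq> {}" "B \<noteq> {}" using A B S by (auto simp: partition_on_def)
    have AB: "partition_on (S \<union> (C - S)) (A \<union> B)" "A \<inter> B = {}"
      using partition_on_disjoint_Un[OF A(1) B(1)] by auto
    have SC: "S \<union> (C - S) = C" using S by auto
    note R = partition_on_remove_block[OF PW C]
    have N: "partition_on (C \<union> (V - C)) ((A \<union> B) \<union> (W - {C}))" "(A \<union> B) \<inter> (W - {C}) = {}"
      using partition_on_disjoint_Un[OF AB(1)[unfolded SC] R] by auto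
    have NV: "partition_on V ((A \<union> B) \<union> (W - {C}))"
      using N(1) CV by (simp add: Un_absorb1)
    have "sum f ((A \<union> B) \<union> (W - {C})) = sum f A + sum f B + sum f (W - {C})"
      using N(2) AB(2) fin finW by (simp add: sum.union_disjoint)
    also have "\<dots> \<le> g C + sum f (W - {C})"
      using separator_splits[OF sepS _ CV] S A B by auto
    also have "\<dots> \<le> f C + sum f (W - {C})"
      using dilworth_truncation_le_self[OF finite_subset_V[OF CV], of f] S by auto
    also have "\<dots> = g V" using finW C fW by (simp add: sum.remove)
    finally have "(A \<union> B) \<union> (W - {C}) \<in> Opt"
      using dilworth_truncation_le[OF finite_V NV, of f] NV by (simp add: Opt_def)
    from W(2)[OF this] have "card ((A \<union> B) \<union> (W - {C})) \<le> card W" .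
    moreover have "card ((A \<union> B) \<union> (W - {C})) = card A + card B + (card W - 1)"
      using N(2) AB(2) fin finW C by (simp add: card_Un_disjoint)
    moreover have "card A > 0" "card B > 0"
      using \<open>A \<noteq> {}\<close> \<open>B \<noteq> {}\<close> fin by (auto simp: card_gt_0_iff)
    ultimately show False using cW by linarith
  qed
  have ref: "refines V W P" if P: "partition_on V P" "sum f P = g V" "card P > 1" for P
    unfolding refines_def
  proof (intro conjI ballI PW P(1))
    fix C assume C: "C \<in> W"
    then have "C \<noteq> {}" "C \<subseteq> V" using PW by (auto simp: partition_on_def)
    \<comment> \<open>\<open>D\<close> is the block of \<open>P\<close> through a point of
      \<open>C\<close>. Both are separators, hence so is \<open>C \<inter> D\<close>, and minimality
      of \<open>C\<close> forces \<open>C \<inter> D = C\<close>.\<close>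
    then obtain x where x: "x \<in> C" "x \<in> V" by blast
    then obtain D where D: "D \<in> P" "x \<in> D" using P(1) by (auto simp: partition_on_def)
    have "is_separator V g D" using P(3) D by (intro block_is_separator[OF P(1,2)]) auto
    then have "is_separator V g (C \<inter> D)"
      using separator_Int[OF sep[OF C]] x D by blast
    then have "\<not> C \<inter> D \<subset> C" using min[OF C, of "C \<inter> D"] x D by blast
    then show "\<exists>D\<in>P. C \<subseteq> D" using D by blast
  qed
  show thesis using that[OF PW fW cW sep min ref] .
qed

end

section \<open>The minimum rate and the fundamental partition\<close>

text \<open>The greedy algorithm for the base polytope: each coordinate is the marginal gain of
  \<open>g\<close> when its element is inserted.\<close>

lemma submodular_greedy_vector:
  fixes g :: "'i set \<Rightarrow> real"
  assumes "finite V" "submodular_on V g" "g {} = 0"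
  obtains r where "\<And>X. X \<subseteq> V \<Longrightarrow> sum r X \<le> g X" "sum r V = g V"
proof -
  have "\<exists>r. (\<forall>X. X \<subseteq> V \<longrightarrow> sum r X \<le> g X) \<and> sum r V = g V"
    using assms(1,2)
  proof (induction V rule: finite_induct)
    case empty
    then show ?case using assms(3) by auto
  next
    case (insert v V)
    have "submodular_on V g"
      using insert.prems unfolding submodular_on_def by blast
    then obtain r where r: "\<And>X. X \<subseteq> V \<Longrightarrow> sum r X \<le> g X" "sum r V = g V"
      using insert.IH by blast
    define r' where "r' = r(v := g (insert v V) - g V)"
    have eq: "sum r' X = sum r X" if "X \<subseteq> V" for X
      using that insert.hyps by (intro sum.cong) (auto simp: r'_def)
    have 1: "sum r' (insert v V) = g (insert v V)"
      using insert.hyps eq[of V] r(2) by (simp add: r'_def)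
    have 2: "sum r' X \<le> g X" if X: "X \<subseteq> insert v V" for X
    proof (cases "v \<in> X")
      case True
      have sub: "X - {v} \<subseteq> V" using X by auto
      have finX: "finite X" using X insert.hyps finite_subset by blast
      \<comment> \<open>Diminishing returns: inserting \<open>v\<close> gains at most as much over
        \<open>V\<close> as over the smaller set \<open>X - {v}\<close>.\<close>
      have "g (X \<inter> V) + g (X \<union> V) \<le> g X + g V"
        using insert.prems X unfolding submodular_on_def by blast
      moreover have "X \<inter> V = X - {v}" "X \<union> V = insert v V" using X True insert.hyps by auto
      moreover have "sum r' X = r' v + sum r' (X - {v})"
        using finX True by (simp add: sum.remove)
      moreover have "sum r' (X - {v}) \<le> g (X - {v})"
        using eq[OF sub] r(1)[OF sub] by simp
      ultimately show ?thesis by (simp add: r'_def)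
    next
      case False
      then have "X \<subseteq> V" using X by auto
      then show ?thesis using eq r(1) by simp
    qed
    show ?case using 1 2 by blast
  qed
  then show thesis using that by blast
qed

section \<open>The sharp function, \<open>phi\<close> and optimal partitions\<close>

lemma f_sharp_intersecting_submodular:
  assumes "finite V" "submodular_on V H"
  shows "intersecting_submodular V (f_sharp H V \<alpha>)"
proof
  show "finite V" by fact
next
  fix X Y assume "X \<subseteq> V" "Y \<subseteq> V" "X \<inter> Y \<noteq> {}"
  then show "f_sharp H V \<alpha> (X \<inter> Y) + f_sharp H V \<alpha> (X \<union> Y) \<le> f_sharp H V \<alpha> X + f_sharp H V \<alpha> Y"
    using assms(2) by (auto simp: f_sharp_def submodular_on_def)
qed

text \<open>The bridge between the truncation and \<open>phi\<close>: for nonempty \<open>V\<close>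
  the trivial partition \<open>{V}\<close> has value \<alpha>, and \<open>P\<close> beats it exactly
  when \<open>phi H V P\<close> exceeds \<alpha>.\<close>

lemma sum_f_sharp_partition:
  assumes "partition_on V P" "card P > 1"
  shows "sum (f_sharp H V \<alpha>) P - \<alpha> = (real (card P) - 1) * (\<alpha> - phi H V P)"
proof -
  have "sum (f_sharp H V \<alpha>) P = (\<Sum>C\<in>P. \<alpha> - (H V - H C))"
    using partition_onD3[OF assms(1)] by (intro sum.cong) (auto simp: f_sharp_def)
  also have "\<dots> = real (card P) * \<alpha> - (\<Sum>C\<in>P. H V - H C)"
    by (simp add: sum_subtractf)
  also have "(\<Sum>C\<in>P. H V - H C) = (real (card P) - 1) * phi H V P"
    using assms(2) by (simp add: phi_def sum_divide_distrib[symmetric])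
  finally show ?thesis by (simp add: algebra_simps)
qed

lemma phi_maximizers_nonempty:
  assumes "finite V" "card V > 1"
  shows "phi_maximizers H V \<noteq> {}"
proof -
  have fin: "finite (multiway_partitions V)"
    using finite_partitions[OF assms(1)] by (simp add: multiway_partitions_def)
  have "(\<lambda>x. {x}) ` V \<in> multiway_partitions V"
    using partition_on_singletons[of V] assms
    by (simp add: multiway_partitions_def partitions_def card_image)
  then have "multiway_partitions V \<noteq> {}" by blast
  then obtain P where P: "P \<in> multiway_partitions V"
    "phi H V P = Max (phi H V ` multiway_partitions V)"
    using obtains_MAX[OF fin] by metis
  then have "phi H V Q \<le> phi H V P" if "Q \<in> multiway_partitions V" for Q
    using that fin by simp
  with P(1) show ?thesis by (auto simp: phi_maximizers_def)
qed

text \<open>At the maximum of \<open>phi\<close> no partition with several blocks beats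
  \<open>{V}\<close>, and the maximizer \<open>Q\<close> ties with it.\<close>

lemma dilworth_f_sharp_at_phi_max:
  assumes "finite V" "Q \<in> phi_maximizers H V"
  shows "dilworth_truncation (f_sharp H V (phi H V Q)) V = phi H V Q"
proof -
  let ?a = "phi H V Q" and ?f = "f_sharp H V (phi H V Q)"
  have Q: "partition_on V Q" "card Q > 1"
    and mx: "\<And>P. partition_on V P \<Longrightarrow> card P > 1 \<Longrightarrow> phi H V P \<le> ?a"
    using assms(2) by (auto simp: phi_maximizers_def multiway_partitions_def partitions_def)
  obtain P where P: "partition_on V P" "dilworth_truncation ?f V = sum ?f P"
    using dilworth_truncation_attained[OF assms(1)] .
  have "?a \<le> sum ?f P"
  proof (cases "card P > 1")
    case True
    have "0 \<le> (real (card P) - 1) * (?a - phi H V P)"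
      using True mx[OF P(1) True] by (intro mult_nonneg_nonneg) auto
    then show ?thesis using sum_f_sharp_partition[OF P(1) True, of H ?a] by simp
  next
    case False
    \<comment> \<open>Only the partition \<open>{V}\<close> is left, with value exactly
      \<open>phi H V Q\<close>.\<close>
    have "V \<noteq> {}" using Q by (auto simp: partition_on_empty)
    then have "P \<noteq> {}" using P by (auto simp: partition_on_def)
    then have "card P = 1" using False finite_elements[OF assms(1) P(1)]
      by (metis One_nat_def Suc_lessI card_gt_0_iff)
    then obtain C where "P = {C}" by (auto simp: card_1_singleton_iff)
    then show ?thesis using P(1) \<open>V \<noteq> {}\<close> by (auto simp: f_sharp_def partition_on_def)
  qed
  moreover have "dilworth_truncation ?f V \<le> sum ?f Q"
    using dilworth_truncation_le[OF assms(1) Q(1)] .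
  moreover have "sum ?f Q = ?a"
    using sum_f_sharp_partition[OF Q, of H ?a] by simp
  ultimately show ?thesis using P(2) by linarith
qed

lemma optimal_iff_phi_maximizer:
  assumes "finite V" "Q \<in> phi_maximizers H V"
  shows "P \<in> phi_maximizers H V \<longleftrightarrow> partition_on V P \<and> card P > 1 \<and>
    sum (f_sharp H V (phi H V Q)) P = dilworth_truncation (f_sharp H V (phi H V Q)) V"
proof -
  have "P \<in> phi_maximizers H V \<longleftrightarrow> partition_on V P \<and> card P > 1 \<and> phi H V P = phi H V Q"
    using assms(2) by (fastforce simp: phi_maximizers_def multiway_partitions_def partitions_def)
  also have "\<dots> \<longleftrightarrow> partition_on V P \<and> card P > 1 \<and> sum (f_sharp H V (phi H V Q)) P = phi H V Q"
    using sum_f_sharp_partition[of V P H "phi H V Q"] by fastforce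
  finally show ?thesis unfolding dilworth_f_sharp_at_phi_max[OF assms] .
qed

section \<open>\<open>R_ACO\<close> as the maximum of \<open>phi\<close>\<close>

lemma phi_le_sum_rate:
  assumes "finite V" "partition_on V P" "card P > 1"
    and r: "\<And>X. X \<subset> V \<Longrightarrow> cond_entropy H X (V - X) \<le> sum r X"
  shows "phi H V P \<le> sum r V"
proof -
  have C: "C \<subseteq> V" "C \<noteq> {}" if "C \<in> P" for C
    using assms(2) that by (auto simp: partition_on_def)
  have "(\<Sum>C\<in>P. H V - H C) \<le> (\<Sum>C\<in>P. sum r V - sum r C)"
  proof (rule sum_mono)
    fix C assume "C \<in> P"
    \<comment> \<open>The constraint for the complement of a block bounds \<open>H V - H C\<close>
      by \<open>sum r V - sum r C\<close>. Over all blocks the terms \<open>sum r C\<close> add up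
      to one \<open>sum r V\<close>, which leaves the factor \<open>card P - 1\<close>.\<close>
    then have "V - C \<subset> V" "V - (V - C) = C" "V - C \<union> C = V" using C by blast+
    then have "H V - H C \<le> sum r (V - C)"
      using r[of "V - C"] by (simp add: cond_entropy_def)
    then show "H V - H C \<le> sum r V - sum r C"
      using C(1)[OF \<open>C \<in> P\<close>] assms(1) by (simp add: sum_diff finite_subset)
  qed
  also have "\<dots> = real (card P) * sum r V - (\<Sum>C\<in>P. sum r C)"
    by (simp add: sum_subtractf)
  also have "(\<Sum>C\<in>P. sum r C) = sum r V"
    using sum.partition[OF assms(1,2), of r] by simp
  finally have "(\<Sum>C\<in>P. H V - H C) \<le> (real (card P) - 1) * sum r V"
    by (simp add: algebra_simps)
  then show ?thesis
    using assms(3) by (simp add: phi_def sum_divide_distrib[symmetric] divide_le_eq mult.commute)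
qed

text \<open>A rate vector of sum \<open>\<alpha>\<close> is feasible iff it lies below \<open>f_sharp H V \<alpha>\<close> on nonempty sets
  (complement each constraint), hence a vertex of the base polytope of the truncation is optimal.\<close>

lemma R_ACO_eq_phi_max:
  assumes "finite V" "submodular_on V H" and Q: "Q \<in> phi_maximizers H V"
  shows "R_ACO H V = phi H V Q"
proof -
  let ?a = "phi H V Q" and ?f = "f_sharp H V (phi H V Q)"
  interpret intersecting_submodular V ?f
    using f_sharp_intersecting_submodular[OF assms(1,2)] .
  obtain r where r: "\<And>X. X \<subseteq> V \<Longrightarrow> sum r X \<le> g X" "sum r V = g V"
    using submodular_greedy_vector[OF assms(1) submodular_dilworth dilworth_truncation_empty]
    by blast
  have rV: "sum r V = ?a" using r(2) dilworth_f_sharp_at_phi_max[OF assms(1) Q] by simp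
  have feas: "cond_entropy H X (V - X) \<le> sum r X" if X: "X \<subset> V" for X
  proof -
    have "sum r (V - X) \<le> ?f (V - X)"
      using r(1)[of "V - X"] dilworth_truncation_le_self[of "V - X" ?f] assms(1) X by fastforce
    moreover have "V - X \<noteq> {}" "X \<union> (V - X) = V" using X by auto
    moreover have "sum r (V - X) = sum r V - sum r X"
      using X assms(1) by (intro sum_diff) auto
    ultimately show ?thesis using rV by (simp add: cond_entropy_def f_sharp_def)
  qed
  have "partition_on V Q" "card Q > 1"
    using Q by (auto simp: phi_maximizers_def multiway_partitions_def partitions_def)
  \<comment> \<open>The value at \<open>Q\<close> bounds all feasible vectors from below and
    \<open>r\<close> meets it, so the minimum is attained, as \<open>LEAST\<close> demands.\<close>
  then have lower: "?a \<le> sum s V" if "\<And>X. X \<subset> V \<Longrightarrow> cond_entropy H X (V - X) \<le> sum s X" for s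
    using phi_le_sum_rate[OF assms(1)] that by blast
  show ?thesis unfolding R_ACO_def
  proof (rule Least_equality)
    show "\<exists>r. (\<forall>X. X \<subset> V \<longrightarrow> cond_entropy H X (V - X) \<le> sum r X) \<and> ?a = sum r V"
      using feas rV by metis
  next
    fix y assume "\<exists>r. (\<forall>X. X \<subset> V \<longrightarrow> cond_entropy H X (V - X) \<le> sum r X) \<and> y = sum r V"
    then show "?a \<le> y" using lower by blast
  qed
qed

text \<open>The combinatorial core, separated from probability.\<close>

theorem fundamental_partition_minimal_separators:
  assumes "finite V" "card V > 1" "submodular_on V H"
  defines "g \<equiv> dilworth_truncation (f_sharp H V (R_ACO H V))"
  shows "submodular_on V g" "separable V g"
    "is_minimal_separators V g (fundamental_partition H V)"
proof -
  obtain Q where Q: "Q \<in> phi_maximizers H V"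
    using phi_maximizers_nonempty[OF assms(1,2)] by blast
  let ?f = "f_sharp H V (phi H V Q)"
  have g: "g = dilworth_truncation ?f"
    unfolding g_def R_ACO_eq_phi_max[OF assms(1,3) Q] ..
  interpret F: intersecting_submodular V ?f
    using f_sharp_intersecting_submodular[OF assms(1,3)] .
  note opt = optimal_iff_phi_maximizer[OF assms(1) Q, folded g]
  obtain W where W: "partition_on V W" "sum ?f W = g V" "card W > 1"
    and sep: "\<And>C. C \<in> W \<Longrightarrow> is_separator V g C"
    and min: "\<And>C S. C \<in> W \<Longrightarrow> S \<noteq> {} \<Longrightarrow> S \<subset> C \<Longrightarrow> \<not> is_separator V g S"
    and ref: "\<And>P. partition_on V P \<Longrightarrow> sum ?f P = g V \<Longrightarrow> card P > 1 \<Longrightarrow> refines V W P"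
  proof -
    have "partition_on V Q" "sum ?f Q = g V" "card Q > 1" using opt Q by blast+
    from F.finest_optimal_partition[folded g, OF this] show thesis using that by blast
  qed
  have "fundamental_partition H V = W"
    unfolding fundamental_partition_def
  proof (rule the_equality)
    show "W \<in> phi_maximizers H V \<and> (\<forall>P\<in>phi_maximizers H V. refines V W P)"
      using W ref opt by blast
  next
    fix P assume "P \<in> phi_maximizers H V \<and> (\<forall>Q\<in>phi_maximizers H V. refines V P Q)"
    then have "P \<in> phi_maximizers H V" "refines V P W" using W opt by blast+
    moreover from this(1) have "refines V W P" using ref opt by blast
    \<comment> \<open>Antisymmetry of refinement gives the uniqueness that the description operator
      \<open>THE\<close> requires.\<close>
    ultimately show "P = W" by (intro refines_asym)
  qed
  then show "is_minimal_separators V g (fundamental_partition H V)"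
    using W(1) sep min by (simp add: is_minimal_separators_def partitions_def)
  have "W \<noteq> {}" using W(3) by auto
  then show "separable V g" using sep by (auto simp: separable_def)
  show "submodular_on V g" unfolding g by (rule F.submodular_dilworth)
qed

theorem mainTheorem7:
  fixes M :: "'w measure" and b :: real and V :: "'i set" and Z :: "'i \<Rightarrow> 'w \<Rightarrow> 'b"
    and H :: "'i set \<Rightarrow> real" and R :: real
  assumes "information_space M b"
    and "finite V" and "card V > 1"
    and "\<And>i. i \<in> V \<Longrightarrow> discrete_rv M (Z i)"
    and "\<And>X. X \<subseteq> V \<Longrightarrow> finite_joint_entropy M b Z X"
  defines "H \<equiv> joint_entropy M b Z"
    and "R \<equiv> R_ACO H V"
  shows "submodular_on V (dilworth_truncation (f_sharp H V R))
    \<and> separable V (dilworth_truncation (f_sharp H V R))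
    \<and> is_minimal_separators V (dilworth_truncation (f_sharp H V R)) (fundamental_partition H V)"
proof -
  have H: "submodular_on V H"
    unfolding submodular_on_def H_def
  proof (intro allI impI)
    fix X Y assume "X \<subseteq> V" "Y \<subseteq> V"
    \<comment> \<open>Unions and intersections stay inside \<open>V\<close>, so all four entropies
      are finite.\<close>
    then show "joint_entropy M b Z (X \<inter> Y) + joint_entropy M b Z (X \<union> Y)
        \<le> joint_entropy M b Z X + joint_entropy M b Z Y"
      by (intro information_space.joint_entropy_submodular[OF assms(1)] assms(5)) auto
  qed
  show ?thesis
    unfolding R_def using fundamental_partition_minimal_separators[OF assms(2,3) H] by blast
qed

end
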